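(* Let $d\in\mathbb{N}$ and $\gamma\in\mathbb{R}$. Assume that $q\in[1,\infty]$, $\alpha\in\mathbb{R}$ and $s\in\mathbb{R}$ satisfy $\alpha>\max(1,\alpha_F(d,\gamma))$, where $\alpha_F(d,\gamma):=1+\frac{2+\gamma}{d}$, and $s>s_c:=\frac{2+\gamma}{\alpha-1}-\frac dq$. Then there exists an initial data $u_0\in L^q_s(\mathbb{R}^d)$ such that the problem $\partial_tu-\Delta u=|x|^\gamma|u|^{\alpha-1}u$ with $u(0)=u_0$ has no local positive weak solution (that is, for no $T>0$ does there exist a positive weak solution on $[0,T)$).
   Context: $L^q_s(\mathbb{R}^d)$ is the space of Lebesgue measurable $f$ on $\mathbb{R}^d$ with $\|f\|_{L^q_s}:=\||x|^sf\|_{L^q}<\infty$. Weak solution: let $T>0$. A function $u:[0,T)\times\mathbb{R}^d\to\mathbb{R}$ is a weak solution of the Cauchy problem with $u(0)=u_0$ if $u\in L^\alpha(0,T;L^\alpha_{\frac\gamma\alpha,loc}(\mathbb{R}^d))$, i.e. $\int_0^T\int_K|x|^\gamma|u(t,x)|^\alpha\,dx\,dt<\infty$ for every compact $K\subset\mathbb{R}^d$, and $$\int_{\mathbb{R}^d}u(T',x)\eta(T',x)\,dx-\int_{\mathbb{R}^d}u_0(x)\eta(0,x)\,dx=\int_{[0,T']\times\mathbb{R}^d}u(t,x)(\Delta\eta+\eta_t)(t,x)+|x|^\gamma|u(t,x)|^{\alpha-1}u(t,x)\,\eta(t,x)\,dx\,dt$$ for all $T'\in[0,T)$ and all $\eta\in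 C^{1,2}([0,T]\times\mathbb{R}^d)$ such that $\operatorname{supp}\eta(t,\cdot)$ is compact. *)

theory Defs
  imports "HOL-Probability.Essential_Supremum"
begin

text \<open>
  The norm of \<open>L\<^sup>q(\<real>\<^sup>d)\<close> for \<open>1 \<le> q \<le> \<infinity>\<close>, with values in \<open>[0,\<infinity>]\<close>. The inner case distinction is
  only there because \<open>powr\<close> is not available on \<^typ>\<open>ennreal\<close>.
\<close>

definition Lq_norm :: "ennreal \<Rightarrow> ('a::euclidean_space \<Rightarrow> real) \<Rightarrow> ennreal" where
  "Lq_norm q f =
     (if q = \<infinity> then esssup lebesgue (\<lambda>x. ennreal \<bar>f x\<bar>)
      else let I = (\<integral>\<^sup>+x. ennreal (\<bar>f x\<bar> powr enn2real q) \<partial>lebesgue)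
           in if I = \<infinity> then \<infinity> else ennreal (enn2real I powr (1 / enn2real q)))"

definition weighted_Lq :: "ennreal \<Rightarrow> real \<Rightarrow> ('a::euclidean_space \<Rightarrow> real) set" where
  "weighted_Lq q s =
     {f \<in> borel_measurable lebesgue. Lq_norm q (\<lambda>x. norm x powr s * f x) < \<infinity>}"

definition fujita_exponent :: "nat \<Rightarrow> real \<Rightarrow> real" where
  "fujita_exponent d \<gamma> = 1 + (2 + \<gamma>) / real d"

text \<open>The quotient \<open>d / q\<close> is formed in \<^typ>\<open>ennreal\<close>, where it is \<open>0\<close> for \<open>q = \<infinity>\<close>.\<close>

definition critical_weight :: "nat \<Rightarrow> real \<Rightarrow> real \<Rightarrow> ennreal \<Rightarrow> real" where
  "critical_weight d \<gamma> \<alpha> q = (2 + \<gamma>) / (\<alpha> - 1) - enn2real (of_nat d / q)"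

text \<open>The partial derivative in the direction \<open>b\<close>; only used for \<open>b \<in> Basis\<close>.\<close>

definition partial_at :: "'a::euclidean_space \<Rightarrow> ('a \<Rightarrow> real) \<Rightarrow> 'a \<Rightarrow> real" where
  "partial_at b f x = deriv (\<lambda>h. f (x + h *\<^sub>R b)) 0"

definition has_partial_at :: "'a::euclidean_space \<Rightarrow> ('a \<Rightarrow> real) \<Rightarrow> 'a \<Rightarrow> bool" where
  "has_partial_at b f x \<longleftrightarrow> (\<lambda>h. f (x + h *\<^sub>R b)) field_differentiable (at 0)"

definition laplacian :: "('a::euclidean_space \<Rightarrow> real) \<Rightarrow> 'a \<Rightarrow> real" where
  "laplacian f x = (\<Sum>b\<in>Basis. partial_at b (partial_at b f) x)"

text \<open>The time derivative on \<open>[0,T]\<close>, one-sided at the two endpoints.\<close>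

definition time_deriv :: "real \<Rightarrow> (real \<Rightarrow> 'a \<Rightarrow> real) \<Rightarrow> real \<Rightarrow> 'a \<Rightarrow> real" where
  "time_deriv T \<eta> t x = vector_derivative (\<lambda>\<tau>. \<eta> \<tau> x) (at t within {0..T})"

definition C12 :: "real \<Rightarrow> (real \<Rightarrow> 'a::euclidean_space \<Rightarrow> real) \<Rightarrow> bool" where
  "C12 T \<eta> \<longleftrightarrow>
     continuous_on ({0..T} \<times> UNIV) (\<lambda>(t, x). \<eta> t x) \<and>
     (\<forall>t\<in>{0..T}. \<forall>x. (\<lambda>\<tau>. \<eta> \<tau> x) differentiable (at t within {0..T})) \<and>
     continuous_on ({0..T} \<times> UNIV) (\<lambda>(t, x). time_deriv T \<eta> t x) \<and>
     (\<forall>b\<in>Basis.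
        (\<forall>t\<in>{0..T}. \<forall>x. has_partial_at b (\<eta> t) x) \<and>
        continuous_on ({0..T} \<times> UNIV) (\<lambda>(t, x). partial_at b (\<eta> t) x)) \<and>
     (\<forall>b\<in>Basis. \<forall>c\<in>Basis.
        (\<forall>t\<in>{0..T}. \<forall>x. has_partial_at c (partial_at b (\<eta> t)) x) \<and>
        continuous_on ({0..T} \<times> UNIV) (\<lambda>(t, x). partial_at c (partial_at b (\<eta> t)) x))"

text \<open>
  The supports of the functions \<open>\<eta>(t, \<cdot>)\<close> are compact and contained in a compact set that does not
  depend on \<open>t\<close>. Without this uniformity the support could escape to infinity as \<open>t\<close> approaches
  some \<open>t\<^sub>0\<close>, with \<open>\<eta>\<close> growing arbitrarily fast, and the integrals in the weak formulation would
  in general not exist.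
\<close>

definition admissible_test :: "real \<Rightarrow> (real \<Rightarrow> 'a::euclidean_space \<Rightarrow> real) \<Rightarrow> bool" where
  "admissible_test T \<eta> \<longleftrightarrow>
     C12 T \<eta> \<and> (\<exists>K. compact K \<and> (\<forall>t\<in>{0..T}. closure {x. \<eta> t x \<noteq> 0} \<subseteq> K))"

text \<open>
  Only the values \<open>u t x\<close> with \<open>0 \<le> t < T\<close> matter. Integrability is required explicitly because the
  Bochner integral of a non-integrable function is \<open>0\<close> by convention.
\<close>

definition weak_solution ::
  "real \<Rightarrow> real \<Rightarrow> real \<Rightarrow> ('a::euclidean_space \<Rightarrow> real) \<Rightarrow> (real \<Rightarrow> 'a \<Rightarrow> real) \<Rightarrow> bool" where
  "weak_solution \<gamma> \<alpha> T u0 u \<longleftrightarrow>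
     set_borel_measurable lebesgue ({0..<T} \<times> UNIV) (\<lambda>(t, x). u t x) \<and>
     (\<forall>K. compact K \<longrightarrow>
        (\<integral>\<^sup>+p\<in>{0<..<T} \<times> K. (case p of (t, x) \<Rightarrow>
            ennreal (norm x powr \<gamma> * \<bar>u t x\<bar> powr \<alpha>)) \<partial>lebesgue) < \<infinity>) \<and>
     (\<forall>T'\<in>{0..<T}. \<forall>\<eta>. admissible_test T \<eta> \<longrightarrow>
        (let F = (\<lambda>(t, x). u t x * (laplacian (\<eta> t) x + time_deriv T \<eta> t x)
                    + norm x powr \<gamma> * \<bar>u t x\<bar> powr (\<alpha> - 1) * u t x * \<eta> t x)
         in integrable lebesgue (\<lambda>x. u T' x * \<eta> T' x) \<and>
            integrable lebesgue (\<lambda>x. u0 x * \<eta> 0 x) \<and>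
            set_integrable lebesgue ({0..T'} \<times> UNIV) F \<and>
            (\<integral>x. u T' x * \<eta> T' x \<partial>lebesgue) - (\<integral>x. u0 x * \<eta> 0 x \<partial>lebesgue) =
              (LINT p:{0..T'} \<times> UNIV|lebesgue. F p)))"

text \<open>
  Positivity is understood as \<open>u \<ge> 0\<close> almost everywhere in \<open>(0,T) \<times> \<real>\<^sup>d\<close>. This is the weakest
  reading, so a non-existence statement for it covers strictly positive solutions as well.
\<close>

definition positive_weak_solution ::
  "real \<Rightarrow> real \<Rightarrow> real \<Rightarrow> ('a::euclidean_space \<Rightarrow> real) \<Rightarrow> (real \<Rightarrow> 'a \<Rightarrow> real) \<Rightarrow> bool" where
  "positive_weak_solution \<gamma> \<alpha> T u0 u \<longleftrightarrow>
     weak_solution \<gamma> \<alpha> T u0 u \<and>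
     (AE (t, x) in lebesgue. t \<in> {0<..<T} \<longrightarrow> 0 \<le> u t x)"

end

theory Submission
  imports Defs "HOL-Real_Asymp.Real_Asymp"
begin

text \<open>
  The data are \<open>u\<^sub>0(x) = \<bar>x\<bar>\<^bsup>-\<beta>\<^esup>\<close> on the unit ball and \<open>0\<close> outside, with
  \<open>(2+\<gamma>)/(\<alpha>-1) < \<beta> < s + d/q\<close>; such a \<open>\<beta>\<close> exists exactly because \<open>s\<close> exceeds the critical weight.
  The upper bound on \<open>\<beta>\<close> puts \<open>u\<^sub>0\<close> into the weighted Lebesgue space
  (\<open>truncated_power_in_weighted_Lq\<close>), and the lower bound makes \<open>u\<^sub>0\<close> more singular at the origin than
  the scaling of the equation allows.

  Nonexistence is proved by the test function method. The test function is
  \<open>\<eta>(t,x) = ((1 - t/R\<^sup>2)\<^sub>+ (1 - \<bar>x\<bar>\<^sup>2/R\<^sup>2)\<^sub>+)\<^sup>k\<close> with a large integer \<open>k\<close>; it is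
  admissible and vanishes from time \<open>R\<^sup>2\<close> on. Up to a constant factor, \<open>\<Delta>\<eta> + \<eta>\<^sub>t\<close> is bounded below by
  \<open>-R\<^sup>-\<^sup>2 \<eta>\<^bsup>(k-1)/k\<^esup>\<close> (\<open>parabolic_cutoff_adjoint_heat_lower_bound\<close>), so for a nonnegative solution the
  linear term \<open>u (\<Delta>\<eta> + \<eta>\<^sub>t)\<close> is absorbed by \<open>\<bar>x\<bar>\<^sup>\<gamma> u\<^sup>\<alpha> \<eta>\<close> up to an error
  of order \<open>(R\<^sup>-\<^sup>2)\<^bsup>\<alpha>/(\<alpha>-1)\<^esup> \<bar>x\<bar>\<^bsup>-\<gamma>/(\<alpha>-1)\<^esup>\<close> that does not involve \<open>u\<close>
  (\<open>absorption_lower_bound\<close>). Integration over the cylinder of height \<open>R\<^sup>2\<close> and radius \<open>R\<close> gives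
  (\<open>parabolic_mass_bound\<close>), after rescaling to \<open>R = 1\<close>,
  the bound \<open>\<integral> u\<^sub>0 \<eta>(0,\<cdot>) \<le> C R\<^bsup>d-(2+\<gamma>)/(\<alpha>-1)\<^esup>\<close>. The constant is finite when
  \<open>\<bar>x\<bar>\<^bsup>-\<gamma>/(\<alpha>-1)\<^esup>\<close> is integrable near the origin, and this follows from \<open>\<alpha>\<close> exceeding the Fujita
  exponent. For the chosen data the left-hand side is a positive multiple of
  \<open>R\<^bsup>d-\<beta>\<^esup>\<close>, or infinite, and letting \<open>R\<close> tend to \<open>0\<close> yields a contradiction for every \<open>T > 0\<close>.
\<close>

section \<open>The parabolic test function\<close>

lemma has_real_derivative_pos_part_power:
  fixes y :: real
  assumes "2 \<le> k"
  shows "((\<lambda>y. max 0 y ^ k) has_real_derivative real k * max 0 y ^ (k - 1)) (at y)"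
proof -
  consider "y < 0" | "y > 0" | "y = 0" by linarith
  then show ?thesis
  proof cases
    case 1
    have "((\<lambda>y. max 0 y ^ k) has_real_derivative 0) (at y)"
      by (rule has_field_derivative_transform_within_open[OF DERIV_const, of "{..<0}"])
        (use 1 assms in \<open>auto simp: max_def\<close>)
    then show ?thesis using 1 assms by (simp add: max_absorb1 zero_power)
  next
    case 2
    have "((\<lambda>y. y ^ k) has_real_derivative real k * y ^ (k - 1)) (at y)"
      using assms by (auto intro!: derivative_eq_intros)
    then have "((\<lambda>y. max 0 y ^ k) has_real_derivative real k * y ^ (k - 1)) (at y)"
      by (rule has_field_derivative_transform_within_open[of _ _ _ "{0<..}"])
        (use 2 in \<open>auto simp: max_def\<close>)
    then show ?thesis using 2 by (simp add: max_def)
  next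
    case 3
    have "((\<lambda>h::real. \<bar>h\<bar>) \<longlongrightarrow> 0) (at 0)"
      by (rule tendsto_eq_intros tendsto_ident_at refl | simp)+
    moreover have "eventually (\<lambda>h::real. norm (max 0 h ^ k / h) \<le> \<bar>h\<bar>) (at 0)"
    proof -
      have "norm (max 0 h ^ k / h) \<le> \<bar>h\<bar>" if "\<bar>h\<bar> < 1" "h \<noteq> 0" for h :: real
      proof (cases "h > 0")
        case True
        have "h ^ k \<le> h ^ 2" using that True assms by (intro power_decreasing) auto
        then show ?thesis using True by (simp add: max_def field_simps power2_eq_square)
      qed (use assms in \<open>auto simp: max_def zero_power\<close>)
      moreover have "eventually (\<lambda>h::real. \<bar>h\<bar> < 1 \<and> h \<noteq> 0) (at 0)"
        by (auto simp: eventually_at dist_real_def intro!: exI[of _ 1])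
      ultimately show ?thesis by (auto elim!: eventually_mono)
    qed
    ultimately have "((\<lambda>h::real. max 0 h ^ k / h) \<longlongrightarrow> 0) (at 0)"
      by (rule Lim_null_comparison[rotated])
    then show ?thesis using 3 assms by (simp add: DERIV_def zero_power)
  qed
qed

text \<open>
  Powers of the positive part are used as cutoffs instead of smooth bump functions: their derivatives
  are again powers of the positive part, with a smaller exponent, so the derivatives of the test
  function are explicit and are controlled by powers of the test function itself. The parameter
  \<open>R\<close> is the spatial radius; time is rescaled by \<open>R\<^sup>2\<close>.
\<close>

definition space_cutoff :: "nat \<Rightarrow> real \<Rightarrow> 'a::euclidean_space \<Rightarrow> real" where
  "space_cutoff k R x = max 0 (1 - (x \<bullet> x) / R\<^sup>2) ^ k"

definition time_cutoff :: "nat \<Rightarrow> real \<Rightarrow> real \<Rightarrow> real" where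
  "time_cutoff k R t = max 0 (1 - t / R\<^sup>2) ^ k"

definition parabolic_cutoff :: "nat \<Rightarrow> real \<Rightarrow> real \<Rightarrow> 'a::euclidean_space \<Rightarrow> real" where
  "parabolic_cutoff k R t x = time_cutoff k R t * space_cutoff k R x"

lemma continuous_on_space_cutoff [continuous_intros]:
  "continuous_on A f \<Longrightarrow> continuous_on A (\<lambda>x. space_cutoff k R (f x))"
  unfolding space_cutoff_def divide_inverse by (intro continuous_intros)

lemma continuous_on_time_cutoff [continuous_intros]:
  "continuous_on A f \<Longrightarrow> continuous_on A (\<lambda>x. time_cutoff k R (f x))"
  unfolding time_cutoff_def divide_inverse by (intro continuous_intros)

lemma borel_measurable_space_cutoff [measurable]:
  "(space_cutoff k R :: 'a::euclidean_space \<Rightarrow> real) \<in> borel_measurable borel"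
  by (intro borel_measurable_continuous_onI continuous_intros)

lemma space_cutoff_directional_derivative:
  fixes x b :: "'a::euclidean_space"
  assumes "2 \<le> k"
  shows "((\<lambda>h. space_cutoff k R (x + h *\<^sub>R b)) has_real_derivative
            - (2 * real k / R\<^sup>2) * (x \<bullet> b) * space_cutoff (k - 1) R x) (at 0)"
proof -
  have "((\<lambda>h. 1 - ((x + h *\<^sub>R b) \<bullet> (x + h *\<^sub>R b)) / R\<^sup>2) has_real_derivative
            - (2 * (x \<bullet> b) / R\<^sup>2)) (at 0)"
    unfolding inner_add_left inner_add_right inner_scaleR_left inner_scaleR_right divide_inverse
    by (auto intro!: derivative_eq_intros simp: inner_commute algebra_simps)
  from DERIV_chain2[OF has_real_derivative_pos_part_power[OF assms] this]
  show ?thesis unfolding space_cutoff_def by (simp add: algebra_simps)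
qed

lemma time_cutoff_derivative:
  assumes "2 \<le> k"
  shows "(time_cutoff k R has_real_derivative - (real k / R\<^sup>2) * time_cutoff (k - 1) R t) (at t)"
proof -
  have "((\<lambda>t. 1 - t / R\<^sup>2) has_real_derivative - (1 / R\<^sup>2)) (at t)"
    unfolding divide_inverse by (auto intro!: derivative_eq_intros)
  from DERIV_chain2[OF has_real_derivative_pos_part_power[OF assms] this]
  show ?thesis unfolding time_cutoff_def by (simp add: algebra_simps)
qed

lemma partial_atI:
  assumes "((\<lambda>h. f (x + h *\<^sub>R b)) has_real_derivative D) (at 0)"
  shows "has_partial_at b f x" "partial_at b f x = D"
  using assms by (auto simp: has_partial_at_def partial_at_def field_differentiable_def
      intro!: DERIV_imp_deriv)

lemma parabolic_cutoff_partial: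
  fixes x b :: "'a::euclidean_space"
  assumes "2 \<le> k"
  shows "has_partial_at b (parabolic_cutoff k R t) x"
    and "partial_at b (parabolic_cutoff k R t) x =
           - (2 * real k / R\<^sup>2) * time_cutoff k R t * ((x \<bullet> b) * space_cutoff (k - 1) R x)"
proof -
  have "((\<lambda>h. parabolic_cutoff k R t (x + h *\<^sub>R b)) has_real_derivative
           - (2 * real k / R\<^sup>2) * time_cutoff k R t * ((x \<bullet> b) * space_cutoff (k - 1) R x)) (at 0)"
    unfolding parabolic_cutoff_def
    using DERIV_cmult[OF space_cutoff_directional_derivative[OF assms, of R x b], of "time_cutoff k R t"]
    by (simp add: algebra_simps)
  from partial_atI[OF this] show "has_partial_at b (parabolic_cutoff k R t) x"
    and "partial_at b (parabolic_cutoff k R t) x =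
           - (2 * real k / R\<^sup>2) * time_cutoff k R t * ((x \<bullet> b) * space_cutoff (k - 1) R x)"
    by auto
qed

lemma parabolic_cutoff_second_partial:
  fixes x b c :: "'a::euclidean_space"
  assumes "3 \<le> k"
  shows "has_partial_at c (partial_at b (parabolic_cutoff k R t)) x"
    and "partial_at c (partial_at b (parabolic_cutoff k R t)) x =
           - (2 * real k / R\<^sup>2) * time_cutoff k R t *
             ((c \<bullet> b) * space_cutoff (k - 1) R x
              - (2 * real (k - 1) / R\<^sup>2) * (x \<bullet> b) * (x \<bullet> c) * space_cutoff (k - 2) R x)"
proof -
  have eq: "partial_at b (parabolic_cutoff k R t) =
    (\<lambda>x. - (2 * real k / R\<^sup>2) * time_cutoff k R t * ((x \<bullet> b) * space_cutoff (k - 1) R x))"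
    using assms by (intro ext parabolic_cutoff_partial) auto
  have "((\<lambda>h. (x + h *\<^sub>R c) \<bullet> b) has_real_derivative c \<bullet> b) (at 0)"
    unfolding inner_add_left inner_scaleR_left by (auto intro!: derivative_eq_intros)
  from DERIV_mult[OF this space_cutoff_directional_derivative[of "k - 1" R x c]]
  have "((\<lambda>h. ((x + h *\<^sub>R c) \<bullet> b) * space_cutoff (k - 1) R (x + h *\<^sub>R c)) has_real_derivative
     ((c \<bullet> b) * space_cutoff (k - 1) R x
              - (2 * real (k - 1) / R\<^sup>2) * (x \<bullet> b) * (x \<bullet> c) * space_cutoff (k - 2) R x)) (at 0)"
    using assms by (simp add: algebra_simps numeral_2_eq_2)
  from DERIV_cmult[OF this, of "- (2 * real k / R\<^sup>2) * time_cutoff k R t"]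
  have D: "((\<lambda>h. partial_at b (parabolic_cutoff k R t) (x + h *\<^sub>R c)) has_real_derivative
     - (2 * real k / R\<^sup>2) * time_cutoff k R t *
             ((c \<bullet> b) * space_cutoff (k - 1) R x
              - (2 * real (k - 1) / R\<^sup>2) * (x \<bullet> b) * (x \<bullet> c) * space_cutoff (k - 2) R x)) (at 0)"
    unfolding eq .
  from partial_atI[OF D] show "has_partial_at c (partial_at b (parabolic_cutoff k R t)) x"
    and "partial_at c (partial_at b (parabolic_cutoff k R t)) x =
           - (2 * real k / R\<^sup>2) * time_cutoff k R t *
             ((c \<bullet> b) * space_cutoff (k - 1) R x
              - (2 * real (k - 1) / R\<^sup>2) * (x \<bullet> b) * (x \<bullet> c) * space_cutoff (k - 2) R x)"
    by auto
qed

lemma parabolic_cutoff_time_deriv: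
  assumes "2 \<le> k" "0 < T" "t \<in> {0..T}"
  shows "(\<lambda>\<tau>. parabolic_cutoff k R \<tau> x) differentiable (at t within {0..T})"
    and "time_deriv T (parabolic_cutoff k R) t x =
           - (real k / R\<^sup>2) * time_cutoff (k - 1) R t * space_cutoff k R x"
proof -
  have "((\<lambda>\<tau>. parabolic_cutoff k R \<tau> x) has_real_derivative
           - (real k / R\<^sup>2) * time_cutoff (k - 1) R t * space_cutoff k R x) (at t)"
    unfolding parabolic_cutoff_def
    by (rule DERIV_cmult_right[OF time_cutoff_derivative[OF assms(1)]])
  then have D: "((\<lambda>\<tau>. parabolic_cutoff k R \<tau> x) has_vector_derivative
           - (real k / R\<^sup>2) * time_cutoff (k - 1) R t * space_cutoff k R x) (at t within {0..T})"
    by (simp add: has_real_derivative_iff_has_vector_derivative has_vector_derivative_at_within)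
  then show "(\<lambda>\<tau>. parabolic_cutoff k R \<tau> x) differentiable (at t within {0..T})"
    by (rule differentiableI_vector)
  show "time_deriv T (parabolic_cutoff k R) t x =
           - (real k / R\<^sup>2) * time_cutoff (k - 1) R t * space_cutoff k R x"
    unfolding time_deriv_def
    using vector_derivative_within_cbox[of 0 T t] assms D by (simp add: cbox_interval)
qed

lemma space_cutoff_eq_0:
  fixes x :: "'a::euclidean_space"
  assumes "0 < R" "R \<le> norm x" "k \<noteq> 0"
  shows "space_cutoff k R x = 0"
proof -
  have "R\<^sup>2 \<le> x \<bullet> x" using assms by (simp add: dot_square_norm power_mono)
  then show ?thesis using assms by (simp add: space_cutoff_def max_def)
qed

text \<open>
  Two spatial derivatives lower the exponent by two, and the result must still be continuous;
  this is where \<open>k \<ge> 3\<close> comes from.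
\<close>

lemma admissible_parabolic_cutoff:
  assumes "3 \<le> k" "0 < T" "0 < R"
  shows "admissible_test T (parabolic_cutoff k R :: real \<Rightarrow> 'a::euclidean_space \<Rightarrow> real)"
proof -
  let ?S = "{0..T} \<times> (UNIV :: 'a set)"
  have "continuous_on ?S (\<lambda>(t, x). parabolic_cutoff k R t x)"
    unfolding parabolic_cutoff_def split_def by (intro continuous_intros)
  moreover have "continuous_on ?S (\<lambda>(t, x). time_deriv T (parabolic_cutoff k R) t x)"
  proof -
    have "continuous_on ?S (\<lambda>p. - (real k / R\<^sup>2) * time_cutoff (k - 1) R (fst p) * space_cutoff k R (snd p))"
      by (intro continuous_intros)
    then show ?thesis
      using assms by (rule_tac continuous_on_cong[THEN iffD1, OF refl])
        (auto simp: parabolic_cutoff_time_deriv)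
  qed
  moreover have "continuous_on ?S (\<lambda>(t, x). partial_at b (parabolic_cutoff k R t) x)" for b
    using assms unfolding split_def
    by (subst parabolic_cutoff_partial) (auto intro!: continuous_intros)
  moreover have "continuous_on ?S (\<lambda>(t, x). partial_at c (partial_at b (parabolic_cutoff k R t)) x)" for b c
    using assms unfolding split_def
    by (subst parabolic_cutoff_second_partial) (auto intro!: continuous_intros)
  ultimately have "C12 T (parabolic_cutoff k R :: real \<Rightarrow> 'a \<Rightarrow> real)"
    using assms unfolding C12_def
    by (auto intro: parabolic_cutoff_time_deriv parabolic_cutoff_partial parabolic_cutoff_second_partial)
  moreover have "closure {x::'a. parabolic_cutoff k R t x \<noteq> 0} \<subseteq> cball 0 R" for t
  proof (rule closure_minimal)
    show "{x::'a. parabolic_cutoff k R t x \<noteq> 0} \<subseteq> cball 0 R"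
      using assms space_cutoff_eq_0[of R _ k] by (force simp: parabolic_cutoff_def)
  qed simp
  ultimately show ?thesis
    unfolding admissible_test_def by (intro conjI exI[of _ "cball 0 R"]) auto
qed

lemma laplacian_parabolic_cutoff:
  fixes x :: "'a::euclidean_space"
  assumes "3 \<le> k"
  shows "laplacian (parabolic_cutoff k R t) x =
    - (2 * real k / R\<^sup>2) * time_cutoff k R t *
       (DIM('a) * space_cutoff (k - 1) R x
         - (2 * real (k - 1) / R\<^sup>2) * (x \<bullet> x) * space_cutoff (k - 2) R x)"
proof -
  have "laplacian (parabolic_cutoff k R t) x = (\<Sum>b\<in>Basis. - (2 * real k / R\<^sup>2) * time_cutoff k R t *
             ((b \<bullet> b) * space_cutoff (k - 1) R x
              - (2 * real (k - 1) / R\<^sup>2) * ((x \<bullet> b) * (x \<bullet> b)) * space_cutoff (k - 2) R x))"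
    unfolding laplacian_def using assms by (simp add: parabolic_cutoff_second_partial mult.assoc)
  also have "\<dots> = - (2 * real k / R\<^sup>2) * time_cutoff k R t *
             (\<Sum>b\<in>Basis. space_cutoff (k - 1) R x
              - (2 * real (k - 1) / R\<^sup>2) * ((x \<bullet> b) * (x \<bullet> b)) * space_cutoff (k - 2) R x)"
    by (simp add: sum_distrib_left)
  also have "(\<Sum>b\<in>Basis. space_cutoff (k - 1) R x
              - (2 * real (k - 1) / R\<^sup>2) * ((x \<bullet> b) * (x \<bullet> b)) * space_cutoff (k - 2) R x) =
    DIM('a) * space_cutoff (k - 1) R x
         - (2 * real (k - 1) / R\<^sup>2) * (x \<bullet> x) * space_cutoff (k - 2) R x"
    by (simp only: sum_subtractf sum_constant sum_distrib_left[symmetric] sum_distrib_right[symmetric]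
        euclidean_inner[of x x, symmetric])
  finally show ?thesis .
qed

text \<open>
  Only a lower bound is needed, because the solution is nonnegative. The part of the Laplacian that
  loses two powers of the cutoff, coming from the squared gradient, is nonnegative and can be dropped.
  What remains loses one power and scales like \<open>R\<close> to the power \<open>-2\<close>.
\<close>

lemma parabolic_cutoff_adjoint_heat_lower_bound:
  fixes x :: "'a::euclidean_space"
  assumes "3 \<le> k" "0 < R" "0 < T" "t \<in> {0..T}"
  shows "laplacian (parabolic_cutoff k R t) x + time_deriv T (parabolic_cutoff k R) t x
    \<ge> - ((2 * DIM('a) + 1) * real k / R\<^sup>2) * (time_cutoff 1 R t * space_cutoff 1 R x) ^ (k - 1)"
proof -
  define a where "a = time_cutoff 1 R t"
  define p where "p = space_cutoff 1 R x"
  define C where "C = real k / R\<^sup>2"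
  have a: "0 \<le> a" "a \<le> 1" and p: "0 \<le> p" "p \<le> 1"
    using assms by (auto simp: a_def p_def time_cutoff_def space_cutoff_def)
  have pw: "time_cutoff j R t = a ^ j" "space_cutoff j R x = p ^ j" for j
    by (auto simp: a_def p_def time_cutoff_def space_cutoff_def)
  have C: "0 \<le> C" by (simp add: C_def)
  obtain j where j: "k = Suc j" using assms by (cases k) auto
  have 1: "a ^ k * p ^ j \<le> (a * p) ^ j" and 2: "a ^ j * p ^ k \<le> (a * p) ^ j"
    using a p by (auto simp: j power_mult_distrib mult_left_le_one_le mult_left_le mult_left_mono mult_right_mono)
  have nn: "0 \<le> 2 * C * a ^ k * ((2 * real (k - 1) / R\<^sup>2) * (x \<bullet> x) * p ^ (k - 2))"
    using C a p by (intro mult_nonneg_nonneg) auto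
  have "laplacian (parabolic_cutoff k R t) x + time_deriv T (parabolic_cutoff k R) t x
    = - (2 * C * DIM('a)) * (a ^ k * p ^ j) + 2 * C * a ^ k * ((2 * real (k - 1) / R\<^sup>2) * (x \<bullet> x) * p ^ (k - 2))
      - C * (a ^ j * p ^ k)"
    using assms by (simp add: laplacian_parabolic_cutoff parabolic_cutoff_time_deriv pw C_def j algebra_simps)
  moreover have "(2 * C * DIM('a)) * (a ^ k * p ^ j) \<le> (2 * C * DIM('a)) * (a * p) ^ j"
    using C 1 by (intro mult_left_mono) auto
  moreover have "C * (a ^ j * p ^ k) \<le> C * (a * p) ^ j"
    using C 2 by (intro mult_left_mono) auto
  moreover have "((2 * DIM('a) + 1) * real k / R\<^sup>2) * (a * p) ^ (k - 1) =
      (2 * C * DIM('a)) * (a * p) ^ j + C * (a * p) ^ j"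
    by (simp add: j C_def divide_inverse algebra_simps)
  ultimately show ?thesis
    using nn unfolding a_def[symmetric] p_def[symmetric] mult_minus_left by linarith
qed

section \<open>Scaling and integrability of powers of the norm\<close>

lemma nn_integral_lebesgue_scaleR:
  fixes f :: "'a::euclidean_space \<Rightarrow> ennreal"
  assumes [measurable]: "f \<in> borel_measurable borel" and "0 < R"
  shows "(\<integral>\<^sup>+x. f x \<partial>lebesgue) = ennreal (R ^ DIM('a)) * (\<integral>\<^sup>+x. f (R *\<^sub>R x) \<partial>lebesgue)"
proof -
  have "(\<integral>\<^sup>+x. f x \<partial>lborel) =
      (\<integral>\<^sup>+x. f x \<partial>density (distr lborel borel (\<lambda>x::'a. 0 + R *\<^sub>R x)) (\<lambda>_. ennreal (\<bar>R\<bar> ^ DIM('a))))"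
    using assms lborel_affine[of R "0::'a"] by simp
  also have "\<dots> = ennreal (R ^ DIM('a)) * (\<integral>\<^sup>+x. f (R *\<^sub>R x) \<partial>lborel)"
    using assms by (simp add: nn_integral_density nn_integral_distr nn_integral_cmult)
  finally show ?thesis by (simp add: nn_integral_completion)
qed

text \<open>
  Dyadic decomposition: at distance about \<open>2\<^bsup>-n\<^esup>\<close> from the origin the integrand is at most
  \<open>2\<^bsup>b(n+1)\<^esup>\<close>, while the ball of that radius has volume proportional to \<open>2\<^bsup>-nd\<^esup>\<close>, so that the
  contributions form a geometric series with ratio \<open>2\<^bsup>b-d\<^esup> < 1\<close>.
\<close>

lemma nn_integral_norm_powr_unit_ball_finite:
  assumes b: "b < real DIM('a::euclidean_space)"
  shows "(\<integral>\<^sup>+(x::'a). ennreal (norm x powr (- b)) * indicator (cball 0 1) x \<partial>lebesgue) < \<infinity>"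
proof -
  \<comment> \<open>On the unit ball the power only grows when a negative \<open>b\<close> is replaced by \<open>0\<close>.\<close>
  define c where "c = max 0 b"
  have c: "0 \<le> c" "b \<le> c" "c < real DIM('a)" using b by (auto simp: c_def)
  define V where "V = unit_ball_vol (real DIM('a))"
  have V: "0 \<le> V" by (simp add: V_def)
  define r where "r = (2::real) powr (c - real DIM('a))"
  have r: "0 < r" "r < 1" using c by (auto simp: r_def powr_less_one)
  have dyadic: "ennreal (norm x powr (- b)) * indicator (cball 0 1) x
      \<le> (\<Sum>n. ennreal (2 powr (c * (real n + 1))) * indicator (cball 0 (2 powr (- real n))) x)"
    (is "_ \<le> (\<Sum>n. ?g n x)") for x :: 'a
  proof (cases "x \<noteq> 0 \<and> norm x \<le> 1")
    case True
    define l where "l = - log 2 (norm x)"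
    have l: "0 \<le> l" "norm x = 2 powr (- l)" using True by (auto simp: l_def)
    \<comment> \<open>The index of the dyadic shell that contains \<open>x\<close>.\<close>
    define n where "n = nat \<lfloor>l\<rfloor>"
    have n: "real n \<le> l" "l < real n + 1" using l(1) by (auto simp: n_def)
    have "norm x powr (- b) = 2 powr (l * b)" by (simp add: l(2) powr_powr)
    also have "\<dots> \<le> 2 powr (c * (real n + 1))"
    proof (rule powr_mono)
      have "l * b \<le> l * c" using l(1) c by (intro mult_left_mono) auto
      also have "\<dots> \<le> (real n + 1) * c" using n c by (intro mult_right_mono) auto
      finally show "l * b \<le> c * (real n + 1)" by (simp add: mult.commute)
    qed simp
    finally have "norm x powr (- b) \<le> 2 powr (c * (real n + 1))" .
    moreover have "x \<in> cball 0 (2 powr (- real n))" using n by (simp add: l(2))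
    ultimately have "ennreal (norm x powr (- b)) * indicator (cball 0 1) x \<le> ?g n x"
      using True by (simp add: ennreal_leI)
    also have "\<dots> \<le> (\<Sum>n. ?g n x)"
    proof -
      have "f n \<le> suminf f" for f :: "nat \<Rightarrow> ennreal"
        using sum_le_suminf[of f "{n}"] by simp
      then show ?thesis .
    qed
    finally show ?thesis .
  next
    case False
    then have "ennreal (norm x powr (- b)) * indicator (cball 0 1) x = 0" by (auto simp: indicator_def)
    then show ?thesis by (simp only: zero_le)
  qed
  have le: "(\<integral>\<^sup>+(x::'a). ennreal (norm x powr (- b)) * indicator (cball 0 1) x \<partial>lborel)
     \<le> (\<integral>\<^sup>+(x::'a). (\<Sum>n. ?g n x) \<partial>lborel)"
    by (rule nn_integral_mono) (rule dyadic)
  have shell: "(\<integral>\<^sup>+(x::'a). ?g n x \<partial>lborel) = ennreal (2 powr c * V * r ^ n)" for n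
  proof -
    have pw: "((2::real) powr z) ^ m = 2 powr (z * real m)" for z m
      using powr_realpow[of "2 powr z" m] by (simp add: powr_powr)
    have "c * (real n + 1) + - real n * real DIM('a) = c + (c - real DIM('a)) * real n"
      by (simp add: algebra_simps)
    then have "2 powr (c * (real n + 1)) * (2 powr (- real n)) ^ DIM('a) = 2 powr c * r ^ n"
      by (simp only: r_def pw powr_add[symmetric])
    then have eq: "2 powr (c * (real n + 1)) * (V * (2 powr (- real n)) ^ DIM('a)) = 2 powr c * V * r ^ n"
      by (simp only: mult.assoc mult.left_commute[of _ V])
    have "(\<integral>\<^sup>+(x::'a). ?g n x \<partial>lborel)
        = ennreal (2 powr (c * (real n + 1))) * emeasure lborel (cball (0::'a) (2 powr (- real n)))"
      by (rule nn_integral_cmult_indicator) simp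
    then show ?thesis
      using V by (simp only: emeasure_cball powr_ge_zero V_def[symmetric] ennreal_mult[symmetric]
          mult_nonneg_nonneg zero_le_power eq)
  qed
  have "(\<integral>\<^sup>+(x::'a). (\<Sum>n. ?g n x) \<partial>lborel) = (\<Sum>n. \<integral>\<^sup>+(x::'a). ?g n x \<partial>lborel)"
    by (intro nn_integral_suminf borel_measurable_times_ennreal borel_measurable_const
        borel_measurable_indicator) simp
  moreover have "(\<Sum>n. ennreal (2 powr c * V * r ^ n)) = ennreal (2 powr c * V * (1 / (1 - r)))"
    using r V by (intro suminf_ennreal_eq sums_mult geometric_sums) auto
  ultimately have "(\<integral>\<^sup>+(x::'a). (\<Sum>n. ?g n x) \<partial>lborel) = ennreal (2 powr c * V * (1 / (1 - r)))"
    by (simp only: shell)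
  then have "(\<integral>\<^sup>+(x::'a). (\<Sum>n. ?g n x) \<partial>lborel) < \<infinity>"
    by (simp only: infinity_ennreal_def ennreal_less_top)
  with le show ?thesis unfolding nn_integral_completion by (rule order.strict_trans1)
qed

section \<open>The initial data\<close>

definition truncated_power :: "real \<Rightarrow> 'a::euclidean_space \<Rightarrow> real" where
  "truncated_power \<beta> x = norm x powr (- \<beta>) * indicat_real (cball 0 1) x"

lemma truncated_power_nonneg: "0 \<le> truncated_power \<beta> x"
  by (simp add: truncated_power_def)

lemma borel_measurable_truncated_power [measurable]:
  "(truncated_power \<beta> :: 'a::euclidean_space \<Rightarrow> real) \<in> borel_measurable borel"
  unfolding truncated_power_def[abs_def]
  by (intro borel_measurable_times borel_measurable_indicator) auto

text \<open>
  For finite \<open>q\<close> the \<open>q\<close>-th power of the weighted function is \<open>\<bar>x\<bar>\<close> to the power \<open>-(\<beta>-s)q\<close> on the unit ball,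
  and \<open>(\<beta>-s)q < d\<close>. For \<open>q = \<infinity>\<close> the quotient \<open>d/q\<close> is \<open>0\<close>, so the weighted function is a positive
  power of the norm on the unit ball and hence bounded.
\<close>

lemma truncated_power_in_weighted_Lq:
  assumes q: "1 \<le> q" and \<beta>: "\<beta> < s + enn2real (of_nat DIM('a::euclidean_space) / q)"
  shows "(truncated_power \<beta> :: 'a \<Rightarrow> real) \<in> weighted_Lq q s"
proof -
  have prod: "norm x powr s * truncated_power \<beta> x = norm x powr (s - \<beta>) * indicat_real (cball 0 1) x"
    for x :: 'a by (simp add: truncated_power_def powr_diff powr_minus_divide)
  have "Lq_norm q (\<lambda>x::'a. norm x powr s * truncated_power \<beta> x) < \<infinity>"
  proof (cases "q = \<infinity>")
    case True
    have "\<beta> < s" using \<beta> True by simp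
    have "esssup lebesgue (\<lambda>x::'a. ennreal \<bar>norm x powr (s - \<beta>) * indicat_real (cball 0 1) x\<bar>) \<le> 1"
    proof (rule esssup_I)
      have "norm x powr (s - \<beta>) \<le> 1" if "norm x \<le> 1" for x :: 'a
        using that \<open>\<beta> < s\<close> by (intro powr_le1) auto
      then show "AE (x::'a) in lebesgue. ennreal \<bar>norm x powr (s - \<beta>) * indicat_real (cball 0 1) x\<bar> \<le> 1"
        by (auto simp: indicator_def)
    next
      show "(\<lambda>x::'a. ennreal \<bar>norm x powr (s - \<beta>) * indicat_real (cball 0 1) x\<bar>) \<in> borel_measurable lebesgue"
        by (intro measurable_completion measurable_compose[OF _ measurable_ennreal] borel_measurable_abs
            borel_measurable_times borel_measurable_indicator) simp_all
    qed
    also have "(1::ennreal) < \<infinity>" by simp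
    finally show ?thesis by (simp add: Lq_norm_def True prod)
  next
    case False
    define r where "r = enn2real q"
    have r: "q = ennreal r" "1 \<le> r"
      using False q by (cases q; auto simp: r_def)+
    have "enn2real (of_nat DIM('a) / q) = real DIM('a) / r"
      using r by (simp add: ennreal_of_nat_eq_real_of_nat divide_ennreal)
    then have "\<beta> - s < real DIM('a) / r" using \<beta> by simp
    then have "(\<beta> - s) * r < real DIM('a)" using r by (simp add: pos_less_divide_eq)
    have "(\<integral>\<^sup>+(x::'a). ennreal (\<bar>norm x powr (s - \<beta>) * indicat_real (cball 0 1) x\<bar> powr r) \<partial>lebesgue)
        = (\<integral>\<^sup>+(x::'a). ennreal (norm x powr (- ((\<beta> - s) * r))) * indicator (cball 0 1) x \<partial>lebesgue)"
    proof (rule nn_integral_cong)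
      fix x :: 'a
      have "(norm x powr (s - \<beta>)) powr r = norm x powr (- ((\<beta> - s) * r))"
        by (simp add: powr_powr left_diff_distrib)
      then show "ennreal (\<bar>norm x powr (s - \<beta>) * indicat_real (cball 0 1) x\<bar> powr r)
          = ennreal (norm x powr (- ((\<beta> - s) * r))) * indicator (cball 0 1) x"
        by (cases "x \<in> cball 0 1") (simp_all del: mem_cball mem_cball_0)
    qed
    also have "\<dots> < \<infinity>"
      by (rule nn_integral_norm_powr_unit_ball_finite) fact
    finally have "(\<integral>\<^sup>+(x::'a). ennreal (\<bar>norm x powr (s - \<beta>) * indicat_real (cball 0 1) x\<bar> powr r) \<partial>lebesgue) < \<infinity>" .
    then show ?thesis using False by (simp add: Lq_norm_def prod Let_def r_def)
  qed
  moreover have "(truncated_power \<beta> :: 'a \<Rightarrow> real) \<in> borel_measurable lebesgue"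
    by (intro measurable_completion) simp
  ultimately show ?thesis by (simp add: weighted_Lq_def)
qed

section \<open>A priori bound for the mass of the initial data\<close>

text \<open>
  A form of Young's inequality. The superlinear term absorbs the linear one unless
  \<open>w u\<^bsup>\<alpha>-1\<^esup> e < M\<close>, and in that case \<open>u\<close> itself is under control. Here \<open>e\<close> stands for the base of
  the cutoff and \<open>g\<close> for the adjoint heat operator applied to \<open>e\<^sup>k\<close>. The exponent \<open>k\<close> has to be
  large, since the bound on \<open>u\<close> degenerates like \<open>e\<close> to the power \<open>-1/(\<alpha>-1)\<close> where the cutoff
  vanishes, and the factor \<open>e\<^bsup>k-1\<^esup>\<close> has to compensate for this.
\<close>

lemma absorption_lower_bound:
  fixes u g w e M \<alpha> :: real
  assumes "0 \<le> u" "0 < w" "0 < M" "0 \<le> e" "e \<le> 1" "1 < \<alpha>" "1 / (\<alpha> - 1) \<le> real (k - 1)"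
    and g: "- M * e ^ (k - 1) \<le> g"
  shows "- (M * (M / w) powr (1 / (\<alpha> - 1))) \<le> u * g + w * (u powr (\<alpha> - 1)) * u * e ^ k"
proof -
  let ?r = "1 / (\<alpha> - 1)"
  have r: "0 < ?r" using \<open>1 < \<alpha>\<close> by simp
  then obtain j where j: "k = Suc j" using assms by (cases k) auto
  have "u * g \<ge> u * (- M * e ^ j)" using assms by (intro mult_left_mono) (auto simp: j)
  then have "u * g + w * (u powr (\<alpha> - 1)) * u * e ^ k \<ge> u * e ^ j * (w * u powr (\<alpha> - 1) * e - M)"
    by (simp add: j algebra_simps)
  moreover have "u * e ^ j * (w * u powr (\<alpha> - 1) * e - M) \<ge> - (M * (M / w) powr ?r)"
  proof (cases "w * u powr (\<alpha> - 1) * e \<ge> M")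
    case True
    then have "0 \<le> u * e ^ j * (w * u powr (\<alpha> - 1) * e - M)" using assms by simp
    moreover have "0 \<le> M * (M / w) powr ?r" using assms by simp
    ultimately show ?thesis by linarith
  next
    case False
    have "u * e ^ j \<le> u * e powr ?r"
    proof (cases "e = 0")
      case True
      have "0 < real j" using r assms by (simp only: j diff_Suc_1)
      then show ?thesis using True by (simp add: zero_power)
    next
      case False
      then have "e ^ j = e powr real j" using assms by (simp add: powr_realpow)
      also have "\<dots> \<le> e powr ?r" using assms False by (intro powr_mono') (auto simp: j)
      finally show ?thesis using assms by (intro mult_left_mono) auto
    qed
    also have "\<dots> = (u powr (\<alpha> - 1) * e) powr ?r"
      using assms by (simp add: powr_mult powr_powr)
    also have "\<dots> \<le> (M / w) powr ?r"
      using False assms by (intro powr_mono2) (auto simp: field_simps)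
    finally have "M * (u * e ^ j) \<le> M * (M / w) powr ?r" using assms by (intro mult_left_mono) auto
    moreover have "0 \<le> u * e ^ j * (w * u powr (\<alpha> - 1) * e)" using assms by simp
    ultimately show ?thesis by (simp add: algebra_simps)
  qed
  ultimately show ?thesis by linarith
qed

lemma ennreal_integral_le_nn_integral:
  assumes "integrable M f"
  shows "ennreal (integral\<^sup>L M f) \<le> (\<integral>\<^sup>+x. ennreal (f x) \<partial>M)"
proof -
  have "(\<integral>\<^sup>+x. ennreal (f x) \<partial>M) \<noteq> \<infinity>"
    using assms by (auto simp: real_integrable_def)
  moreover have "integral\<^sup>L M f \<le> enn2real (\<integral>\<^sup>+x. ennreal (f x) \<partial>M)"
    using assms by (simp add: real_lebesgue_integral_def)
  then have "ennreal (integral\<^sup>L M f) \<le> ennreal (enn2real (\<integral>\<^sup>+x. ennreal (f x) \<partial>M))"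
    by (rule ennreal_leI)
  ultimately show ?thesis by (simp add: less_top)
qed

text \<open>
  Nonnegativity of the solution is known for positive times only, and the weight \<open>\<bar>x\<bar>\<^sup>\<gamma>\<close> is positive only
  away from the origin; both exceptional sets lie in hyperplanes.
\<close>

lemma AE_lebesgue_pair_nonzero:
  "AE p in (lebesgue :: (real \<times> 'a::euclidean_space) measure). fst p \<noteq> 0 \<and> snd p \<noteq> 0"
proof -
  obtain b :: 'a where b: "b \<in> Basis" using SOME_Basis by metis
  have "negligible {p :: real \<times> 'a. (1, 0) \<bullet> p = 0}"
    by (rule negligible_hyperplane) (auto simp: zero_prod_def)
  moreover have "negligible {p :: real \<times> 'a. (0, b) \<bullet> p = 0}"
    using b by (intro negligible_hyperplane) (auto simp: zero_prod_def)
  ultimately have "AE p in lebesgue. p \<notin> {p :: real \<times> 'a. (1, 0) \<bullet> p = 0}"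
    "AE p in lebesgue. p \<notin> {p :: real \<times> 'a. (0, b) \<bullet> p = 0}"
    unfolding negligible_iff_null_sets by (simp_all only: AE_not_in)
  then show ?thesis by eventually_elim (auto simp: inner_prod_def)
qed

text \<open>
  The weak formulation is tested with the parabolic cutoff up to time \<open>R\<^sup>2\<close>, where the cutoff
  vanishes. The boundary term at time \<open>R\<^sup>2\<close> then disappears, and the mass of the initial data equals
  minus the space-time integral, whose integrand the absorption inequality bounds from below by a
  function independent of the solution.
\<close>

lemma parabolic_mass_bound:
  fixes u0 :: "'a::euclidean_space \<Rightarrow> real"
  defines "M \<equiv> \<lambda>k R. (2 * real DIM('a) + 1) * real k / R\<^sup>2"
  assumes sol: "positive_weak_solution \<gamma> \<alpha> T u0 u" and "1 < \<alpha>"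
    and k: "3 \<le> k" "1 / (\<alpha> - 1) \<le> real (k - 1)" and R: "0 < R" "R\<^sup>2 < T"
    and u0: "\<And>x. 0 \<le> u0 x"
  shows "(\<integral>\<^sup>+x. ennreal (u0 x * space_cutoff k R x) \<partial>lebesgue)
    \<le> ennreal (R\<^sup>2 * M k R powr (\<alpha> / (\<alpha> - 1))) *
       (\<integral>\<^sup>+(x::'a). ennreal (norm x powr (- (\<gamma> / (\<alpha> - 1)))) * indicator (cball 0 R) x \<partial>lebesgue)"
proof -
  define \<eta> :: "real \<Rightarrow> 'a \<Rightarrow> real" where "\<eta> = parabolic_cutoff k R"
  define F where "F = (\<lambda>(t, x). u t x * (laplacian (\<eta> t) x + time_deriv T \<eta> t x)
                    + norm x powr \<gamma> * \<bar>u t x\<bar> powr (\<alpha> - 1) * u t x * \<eta> t x)"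
  define S where "S = {0..R\<^sup>2} \<times> (UNIV :: 'a set)"
  have T: "0 < T" using R by (metis less_trans zero_less_power)
  have "admissible_test T \<eta>"
    unfolding \<eta>_def using k T R by (intro admissible_parabolic_cutoff) auto
  moreover have "R\<^sup>2 \<in> {0..<T}" using R by simp
  ultimately have w: "integrable lebesgue (\<lambda>x. u0 x * \<eta> 0 x)" "set_integrable lebesgue S F"
    "(\<integral>x. u (R\<^sup>2) x * \<eta> (R\<^sup>2) x \<partial>lebesgue) - (\<integral>x. u0 x * \<eta> 0 x \<partial>lebesgue) = (LINT p:S|lebesgue. F p)"
    using sol unfolding positive_weak_solution_def weak_solution_def F_def S_def Let_def by blast+
  have \<eta>0: "\<eta> 0 x = space_cutoff k R x" for x
    by (simp add: \<eta>_def parabolic_cutoff_def time_cutoff_def)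
  have "\<eta> (R\<^sup>2) x = 0" for x
    using k R by (simp add: \<eta>_def parabolic_cutoff_def time_cutoff_def)
  with w(3) have J: "(\<integral>x. u0 x * \<eta> 0 x \<partial>lebesgue) = (\<integral>p. - (indicat_real S p * F p) \<partial>lebesgue)"
    by (simp add: set_lebesgue_integral_def)
  define a where "a = \<gamma> / (\<alpha> - 1)"
  define C where "C = M k R powr (\<alpha> / (\<alpha> - 1))"
  have Mpos: "0 < M k R" using k R by (simp add: M_def)
  have low: "- (indicat_real S p * F p)
      \<le> indicator {0..R\<^sup>2} (fst p) * (C * norm (snd p) powr (- a) * indicator (cball (0::'a) R) (snd p))"
    if nz: "fst p \<noteq> 0" "snd p \<noteq> 0" and pos: "fst p \<in> {0<..<T} \<longrightarrow> 0 \<le> u (fst p) (snd p)" for p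
  proof (cases "fst p \<in> {0..R\<^sup>2}")
    case True
    define t x where tx: "t = fst p" "x = snd p"
    have t: "t \<in> {0..T}" and u: "0 \<le> u t x" using True nz pos R by (auto simp: tx)
    define e where "e = time_cutoff 1 R t * space_cutoff 1 R x"
    have e: "0 \<le> e" "e \<le> 1"
      using True by (auto simp: e_def tx time_cutoff_def space_cutoff_def intro!: mult_le_one)
    have \<eta>: "\<eta> t x = e ^ k"
      by (simp add: \<eta>_def e_def parabolic_cutoff_def time_cutoff_def space_cutoff_def power_mult_distrib)
    have g: "- M k R * e ^ (k - 1) \<le> laplacian (\<eta> t) x + time_deriv T \<eta> t x"
      using parabolic_cutoff_adjoint_heat_lower_bound[OF k(1) R(1) T t, of x]
      by (simp add: \<eta>_def e_def M_def add.commute)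
    have F: "F p = u t x * (laplacian (\<eta> t) x + time_deriv T \<eta> t x)
              + norm x powr \<gamma> * u t x powr (\<alpha> - 1) * u t x * e ^ k"
      using u by (simp add: F_def tx split_def \<eta>[unfolded tx])
    have ind: "indicat_real S p = 1" using True by (auto simp: S_def mem_Times_iff)
    show ?thesis
    \<comment> \<open>Outside the ball the cutoff and all its derivatives vanish, and the bound is \<open>0\<close>.\<close>
    proof (cases "norm x \<le> R")
      case inside: True
      have "- (M k R * (M k R / norm x powr \<gamma>) powr (1 / (\<alpha> - 1))) \<le> F p"
        unfolding F using u nz Mpos e \<open>1 < \<alpha>\<close> k g by (intro absorption_lower_bound) (auto simp: tx)
      also have "M k R * (M k R / norm x powr \<gamma>) powr (1 / (\<alpha> - 1)) = C * norm x powr (- a)"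
      proof -
        have "1 + 1 / (\<alpha> - 1) = \<alpha> / (\<alpha> - 1)" using \<open>1 < \<alpha>\<close> by (simp add: field_simps)
        then have "C = M k R powr (1 + 1 / (\<alpha> - 1))" by (simp only: C_def)
        also have "\<dots> = M k R * M k R powr (1 / (\<alpha> - 1))"
          using Mpos by (simp only: powr_add powr_one less_imp_le)
        finally have C: "C = M k R * M k R powr (1 / (\<alpha> - 1))" .
        have "(M k R / norm x powr \<gamma>) powr (1 / (\<alpha> - 1))
            = M k R powr (1 / (\<alpha> - 1)) / (norm x powr \<gamma>) powr (1 / (\<alpha> - 1))"
          by (rule powr_divide)
        also have "(norm x powr \<gamma>) powr (1 / (\<alpha> - 1)) = norm x powr a"
          by (simp only: powr_powr a_def times_divide_eq_right mult_1_right)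
        also have "M k R powr (1 / (\<alpha> - 1)) / norm x powr a
            = M k R powr (1 / (\<alpha> - 1)) * norm x powr (- a)"
          by (simp add: powr_minus_divide)
        finally show ?thesis by (simp only: C mult.assoc)
      qed
      finally show ?thesis using inside True ind by (simp add: tx)
    next
      case False
      then have "space_cutoff 1 R x = 0" using R by (intro space_cutoff_eq_0) auto
      then have "e = 0" by (simp add: e_def)
      then have "0 \<le> F p" unfolding F using u g k by (auto simp: zero_power)
      then show ?thesis using ind False by (simp add: tx)
    qed
  qed (auto simp: S_def indicator_def mem_Times_iff)
  have "(\<integral>\<^sup>+x. ennreal (u0 x * space_cutoff k R x) \<partial>lebesgue) = ennreal (\<integral>x. u0 x * \<eta> 0 x \<partial>lebesgue)"
    using w(1) u0 by (subst nn_integral_eq_integral[symmetric]) (auto simp: \<eta>0 space_cutoff_def)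
  also have "\<dots> \<le> (\<integral>\<^sup>+p. ennreal (- (indicat_real S p * F p)) \<partial>lebesgue)"
    unfolding J using w(2) by (intro ennreal_integral_le_nn_integral) (simp add: set_integrable_def)
  also have "\<dots> \<le> (\<integral>\<^sup>+p. ennreal (indicator {0..R\<^sup>2} (fst p) *
       (C * norm (snd p) powr (- a) * indicator (cball (0::'a) R) (snd p))) \<partial>lebesgue)"
  proof (rule nn_integral_mono_AE)
    have "AE p in lebesgue. fst p \<in> {0<..<T} \<longrightarrow> 0 \<le> u (fst p) (snd p)"
      using sol by (simp add: positive_weak_solution_def split_def)
    with AE_lebesgue_pair_nonzero
    show "AE p in lebesgue. ennreal (- (indicat_real S p * F p)) \<le> ennreal (indicator {0..R\<^sup>2} (fst p) *
       (C * norm (snd p) powr (- a) * indicator (cball (0::'a) R) (snd p)))"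
      by eventually_elim (intro ennreal_leI low, auto)
  qed
  also have "\<dots> = (\<integral>\<^sup>+p. ennreal (indicator {0..R\<^sup>2} (fst p) *
       (C * norm (snd p) powr (- a) * indicator (cball (0::'a) R) (snd p))) \<partial>(lborel \<Otimes>\<^sub>M lborel))"
    by (simp add: nn_integral_completion lborel_prod)
  also have "\<dots> = (\<integral>\<^sup>+t. \<integral>\<^sup>+x. ennreal (indicator {0..R\<^sup>2} t *
       (C * norm x powr (- a) * indicator (cball (0::'a) R) x)) \<partial>lborel \<partial>lborel)"
  proof (subst lborel.nn_integral_fst[symmetric])
    have [measurable]: "(\<lambda>x. indicat_real (cball (0::'a) R) x) \<in> borel_measurable borel"
      "(\<lambda>t. indicat_real {0..R\<^sup>2} t) \<in> borel_measurable borel"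
      by (auto intro!: borel_measurable_indicator)
    show "(\<lambda>p. ennreal (indicator {0..R\<^sup>2} (fst p) *
       (C * norm (snd p) powr (- a) * indicator (cball (0::'a) R) (snd p)))) \<in> borel_measurable (lborel \<Otimes>\<^sub>M lborel)"
      by measurable
  qed simp
  also have "\<dots> = (\<integral>\<^sup>+t. indicator {0..R\<^sup>2} t * (ennreal C * (\<integral>\<^sup>+(x::'a). ennreal (norm x powr (- a)) *
        indicator (cball 0 R) x \<partial>lborel)) \<partial>lborel)"
  proof (rule nn_integral_cong)
    fix t :: real
    have "(\<integral>\<^sup>+x. ennreal (indicator {0..R\<^sup>2} t * (C * norm x powr (- a) * indicator (cball (0::'a) R) x)) \<partial>lborel)
        = (\<integral>\<^sup>+(x::'a). (indicator {0..R\<^sup>2} t * ennreal C) * (ennreal (norm x powr (- a)) * indicator (cball 0 R) x) \<partial>lborel)"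
      by (intro nn_integral_cong) (auto simp: indicator_def ennreal_mult C_def)
    also have "\<dots> = (indicator {0..R\<^sup>2} t * ennreal C) *
        (\<integral>\<^sup>+(x::'a). ennreal (norm x powr (- a)) * indicator (cball 0 R) x \<partial>lborel)"
      by (intro nn_integral_cmult borel_measurable_times_ennreal borel_measurable_indicator) simp_all
    finally show "(\<integral>\<^sup>+x. ennreal (indicator {0..R\<^sup>2} t * (C * norm x powr (- a) * indicator (cball (0::'a) R) x)) \<partial>lborel)
        = indicator {0..R\<^sup>2} t * (ennreal C * (\<integral>\<^sup>+(x::'a). ennreal (norm x powr (- a)) * indicator (cball 0 R) x \<partial>lborel))"
      by (simp only: mult.assoc)
  qed
  also have "\<dots> = ennreal (R\<^sup>2 * C) * (\<integral>\<^sup>+(x::'a). ennreal (norm x powr (- a)) *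
        indicator (cball 0 R) x \<partial>lborel)"
    by (simp add: nn_integral_multc ennreal_mult C_def mult.assoc)
  finally show ?thesis by (simp add: nn_integral_completion C_def a_def)
qed

section \<open>Nonexistence\<close>

lemma truncated_power_mass_scaling:
  assumes R: "0 < R" "R \<le> 1" and "k \<noteq> 0"
  shows "(\<integral>\<^sup>+(x::'a::euclidean_space). ennreal (truncated_power \<beta> x * space_cutoff k R x) \<partial>lebesgue)
    = ennreal (R powr (real DIM('a) - \<beta>)) *
      (\<integral>\<^sup>+(x::'a). ennreal (norm x powr (- \<beta>) * space_cutoff k 1 x) \<partial>lebesgue)"
proof -
  have Rd: "R ^ DIM('a) * R powr (- \<beta>) = R powr (real DIM('a) - \<beta>)"
    using R powr_realpow[of R "DIM('a)"] by (simp add: powr_diff powr_minus_divide)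
  have "(\<integral>\<^sup>+(x::'a). ennreal (truncated_power \<beta> x * space_cutoff k R x) \<partial>lebesgue)
    = ennreal (R ^ DIM('a)) *
      (\<integral>\<^sup>+(x::'a). ennreal (truncated_power \<beta> (R *\<^sub>R x) * space_cutoff k R (R *\<^sub>R x)) \<partial>lebesgue)"
    using R by (intro nn_integral_lebesgue_scaleR) auto
  also have "(\<integral>\<^sup>+(x::'a). ennreal (truncated_power \<beta> (R *\<^sub>R x) * space_cutoff k R (R *\<^sub>R x)) \<partial>lebesgue)
    = (\<integral>\<^sup>+(x::'a). ennreal (R powr (- \<beta>)) * ennreal (norm x powr (- \<beta>) * space_cutoff k 1 x) \<partial>lebesgue)"
  proof (rule nn_integral_cong)
    fix x :: 'a
    have cut: "space_cutoff k R (R *\<^sub>R x) = space_cutoff k 1 x"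
      using R by (simp add: space_cutoff_def power2_eq_square)
    have "truncated_power \<beta> (R *\<^sub>R x) * space_cutoff k 1 x
        = R powr (- \<beta>) * (norm x powr (- \<beta>) * space_cutoff k 1 x)"
    proof (cases "norm x \<le> 1")
      case True
      then have "R * norm x \<le> 1" using R by (intro mult_le_one) auto
      then show ?thesis using R by (simp add: truncated_power_def powr_mult)
    next
      case False
      then have "space_cutoff k 1 x = 0" using \<open>k \<noteq> 0\<close> by (intro space_cutoff_eq_0) auto
      then show ?thesis by simp
    qed
    then show "ennreal (truncated_power \<beta> (R *\<^sub>R x) * space_cutoff k R (R *\<^sub>R x))
      = ennreal (R powr (- \<beta>)) * ennreal (norm x powr (- \<beta>) * space_cutoff k 1 x)"
      by (simp only: cut ennreal_mult'[OF powr_ge_zero, symmetric])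
  qed
  also have "\<dots> = ennreal (R powr (- \<beta>)) *
      (\<integral>\<^sup>+(x::'a). ennreal (norm x powr (- \<beta>) * space_cutoff k 1 x) \<partial>lebesgue)"
    by (simp add: nn_integral_completion nn_integral_cmult)
  finally show ?thesis
    using R by (simp add: mult.assoc[symmetric] ennreal_mult[symmetric] Rd)
qed

lemma norm_powr_ball_scaling:
  assumes R: "0 < R"
  shows "(\<integral>\<^sup>+(x::'a::euclidean_space). ennreal (norm x powr (- a)) * indicator (cball 0 R) x \<partial>lebesgue)
    = ennreal (R powr (real DIM('a) - a)) *
      (\<integral>\<^sup>+(x::'a). ennreal (norm x powr (- a)) * indicator (cball 0 1) x \<partial>lebesgue)"
proof -
  have Rd: "R ^ DIM('a) * R powr (- a) = R powr (real DIM('a) - a)"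
    using R powr_realpow[of R "DIM('a)"] by (simp add: powr_diff powr_minus_divide)
  have "(\<integral>\<^sup>+(x::'a). ennreal (norm x powr (- a)) * indicator (cball 0 R) x \<partial>lebesgue)
    = ennreal (R ^ DIM('a)) *
      (\<integral>\<^sup>+(x::'a). ennreal (norm (R *\<^sub>R x) powr (- a)) * indicator (cball 0 R) (R *\<^sub>R x) \<partial>lebesgue)"
    using R
    by (intro nn_integral_lebesgue_scaleR borel_measurable_times_ennreal borel_measurable_indicator) simp_all
  also have "(\<integral>\<^sup>+(x::'a). ennreal (norm (R *\<^sub>R x) powr (- a)) * indicator (cball 0 R) (R *\<^sub>R x) \<partial>lebesgue)
    = (\<integral>\<^sup>+(x::'a). ennreal (R powr (- a)) * (ennreal (norm x powr (- a)) * indicator (cball 0 1) x) \<partial>lebesgue)"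
    using R by (intro nn_integral_cong) (auto simp: indicator_def powr_mult ennreal_mult)
  also have "\<dots> = ennreal (R powr (- a)) *
      (\<integral>\<^sup>+(x::'a). ennreal (norm x powr (- a)) * indicator (cball 0 1) x \<partial>lebesgue)"
    unfolding nn_integral_completion
    by (intro nn_integral_cmult borel_measurable_times_ennreal borel_measurable_indicator) simp_all
  finally show ?thesis
    using R by (simp add: mult.assoc[symmetric] ennreal_mult[symmetric] Rd)
qed

lemma truncated_power_mass_pos:
  "(\<integral>\<^sup>+(x::'a::euclidean_space). ennreal (norm x powr (- \<beta>) * space_cutoff k 1 x) \<partial>lebesgue) \<noteq> 0"
proof
  assume "(\<integral>\<^sup>+(x::'a). ennreal (norm x powr (- \<beta>) * space_cutoff k 1 x) \<partial>lebesgue) = 0"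
  then have "AE x in lborel. norm x powr (- \<beta>) * space_cutoff k 1 (x::'a) \<le> 0"
    unfolding nn_integral_completion
    by (subst (asm) nn_integral_0_iff_AE) (auto simp: ennreal_eq_0_iff)
  with AE_lborel_singleton[of "0::'a"]
  have "AE x in lborel. x \<notin> ball (0::'a) 1"
  proof eventually_elim
    case (elim x)
    have "0 < space_cutoff k 1 x" if "norm x < 1"
      using that by (simp add: space_cutoff_def dot_square_norm power_less_one_iff)
    with elim show ?case by (auto simp: mult_le_0_iff)
  qed
  then have "emeasure lborel (ball (0::'a) 1) = 0"
    by (subst (asm) AE_iff_measurable[OF _ refl]) (auto simp: ball_def)
  then show False
    using emeasure_ball[of 1 "0::'a"] by (simp add: ennreal_eq_0_iff flip: not_less)
qed

text \<open>
  The mass of the data in a ball of radius \<open>R\<close> is of order \<open>R\<^bsup>d-\<beta>\<^esup>\<close>, while a solution would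
  force it to be at most of order \<open>R\<^bsup>d-\<sigma>\<^esup>\<close> with \<open>\<sigma> = (2+\<gamma>)/(\<alpha>-1)\<close>. For \<open>\<beta> > \<sigma>\<close> this fails as
  \<open>R\<close> tends to \<open>0\<close>, and only small \<open>R\<close> matter, so the lifespan \<open>T\<close> can be arbitrarily short.
  The hypothesis on \<open>\<gamma>\<close> makes the constant in the upper bound finite.
\<close>

lemma no_positive_weak_solution_truncated_power:
  fixes u :: "real \<Rightarrow> 'a::euclidean_space \<Rightarrow> real"
  assumes \<alpha>: "1 < \<alpha>" and \<gamma>: "\<gamma> < real DIM('a) * (\<alpha> - 1)"
    and \<beta>: "(2 + \<gamma>) / (\<alpha> - 1) < \<beta>" and "0 < T"
  shows "\<not> positive_weak_solution \<gamma> \<alpha> T (truncated_power \<beta>) u"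
proof
  assume sol: "positive_weak_solution \<gamma> \<alpha> T (truncated_power \<beta>) u"
  define d where "d = DIM('a)"
  define \<sigma> where "\<sigma> = (2 + \<gamma>) / (\<alpha> - 1)"
  define k where "k = nat \<lceil>1 / (\<alpha> - 1)\<rceil> + 3"
  have k: "3 \<le> k" "1 / (\<alpha> - 1) \<le> real (k - 1)" unfolding k_def by linarith+
  define a where "a = \<gamma> / (\<alpha> - 1)"
  have "a < real DIM('a)" using \<gamma> \<alpha> by (simp add: a_def pos_divide_less_eq)
  define C1 where "C1 = (\<integral>\<^sup>+(x::'a). ennreal (norm x powr (- a)) * indicator (cball 0 1) x \<partial>lebesgue)"
  have C1: "C1 < \<infinity>"
    unfolding C1_def using \<open>a < real DIM('a)\<close> by (rule nn_integral_norm_powr_unit_ball_finite)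
  define C0 where "C0 = (\<integral>\<^sup>+(x::'a). ennreal (norm x powr (- \<beta>) * space_cutoff k 1 x) \<partial>lebesgue)"
  define N where "N = (2 * real d + 1) * real k"
  let ?m = "\<alpha> / (\<alpha> - 1)"
  have expo: "\<beta> - a + 2 - 2 * ?m = \<beta> - \<sigma>"
  proof -
    have "?m = 1 + 1 / (\<alpha> - 1)" using \<alpha> by (simp add: field_simps)
    then show ?thesis by (simp add: a_def \<sigma>_def add_divide_distrib)
  qed
  have bound: "C0 \<le> ennreal (N powr ?m * R powr (\<beta> - \<sigma>)) * C1"
    if R: "0 < R" "R < 1" "R\<^sup>2 < T" for R
  proof -
    have L: "(\<integral>\<^sup>+(x::'a). ennreal (truncated_power \<beta> x * space_cutoff k R x) \<partial>lebesgue)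
        = ennreal (R powr (real d - \<beta>)) * C0"
      unfolding C0_def d_def using R k by (intro truncated_power_mass_scaling) auto
    have U: "(\<integral>\<^sup>+(x::'a). ennreal (norm x powr (- a)) * indicator (cball 0 R) x \<partial>lebesgue)
        = ennreal (R powr (real d - a)) * C1"
      unfolding C1_def d_def using R(1) by (rule norm_powr_ball_scaling)
    have "ennreal (R powr (real d - \<beta>)) * C0
      \<le> ennreal (R\<^sup>2 * (N / R\<^sup>2) powr ?m) * (ennreal (R powr (real d - a)) * C1)"
      using parabolic_mass_bound[OF sol \<alpha> k R(1,3)] truncated_power_nonneg
      unfolding L U[unfolded a_def] a_def N_def d_def by blast
    then have "ennreal (R powr (\<beta> - real d)) * (ennreal (R powr (real d - \<beta>)) * C0)
      \<le> ennreal (R powr (\<beta> - real d)) *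
         (ennreal (R\<^sup>2 * (N / R\<^sup>2) powr ?m) * (ennreal (R powr (real d - a)) * C1))"
      by (rule mult_left_mono) simp
    moreover have "R powr (\<beta> - real d) * R powr (real d - \<beta>) = 1"
      using R by (simp add: powr_add[symmetric])
    moreover have "R powr (\<beta> - real d) * (R\<^sup>2 * (N / R\<^sup>2) powr ?m * R powr (real d - a))
        = N powr ?m * R powr (\<beta> - \<sigma>)"
    proof -
      have R2: "R\<^sup>2 = R powr 2" using R by simp
      have "(N / R\<^sup>2) powr ?m = N powr ?m * R powr (- 2 * ?m)"
        by (simp only: R2 powr_divide powr_powr) (simp add: powr_minus_divide)
      then have "R powr (\<beta> - real d) * (R\<^sup>2 * (N / R\<^sup>2) powr ?m * R powr (real d - a))
          = N powr ?m * (R powr (\<beta> - real d) * R powr 2 * R powr (- 2 * ?m) * R powr (real d - a))"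
        by (simp only: R2 mult_ac)
      also have "R powr (\<beta> - real d) * R powr 2 * R powr (- 2 * ?m) * R powr (real d - a)
          = R powr (\<beta> - real d + 2 + - 2 * ?m + (real d - a))"
        by (simp only: powr_add)
      also have "\<beta> - real d + 2 + - 2 * ?m + (real d - a) = \<beta> - \<sigma>"
        using expo by simp
      finally show ?thesis .
    qed
    ultimately show ?thesis
      by (simp add: mult.assoc[symmetric] ennreal_mult[symmetric])
  qed
  have "((\<lambda>R. ennreal (N powr ?m * R powr (\<beta> - \<sigma>)) * C1) \<longlongrightarrow> ennreal (N powr ?m * 0) * C1) (at_right 0)"
  proof -
    have "((\<lambda>R::real. R powr (\<beta> - \<sigma>)) \<longlongrightarrow> 0) (at_right 0)"
      using \<beta>[folded \<sigma>_def] by real_asymp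
    then show ?thesis
      using C1 unfolding mult.commute[of _ C1]
      by (intro ennreal_tendsto_cmult tendsto_ennrealI tendsto_mult_left) (simp_all add: less_top)
  qed
  moreover have "eventually (\<lambda>R. C0 \<le> ennreal (N powr ?m * R powr (\<beta> - \<sigma>)) * C1) (at_right 0)"
  proof -
    have "eventually (\<lambda>R. 0 < R \<and> R < min 1 (sqrt T)) (at_right (0::real))"
      using \<open>0 < T\<close> eventually_at_right_real[of 0 "min 1 (sqrt T)"] by simp
    then show ?thesis
    proof (rule eventually_mono)
      fix R assume R: "0 < R \<and> R < min 1 (sqrt T)"
      then have "R\<^sup>2 < (sqrt T)\<^sup>2" by (intro power_strict_mono) auto
      then have "R\<^sup>2 < T" using \<open>0 < T\<close> by simp
      with R show "C0 \<le> ennreal (N powr ?m * R powr (\<beta> - \<sigma>)) * C1" by (intro bound) auto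
    qed
  qed
  ultimately have "C0 \<le> ennreal (N powr ?m * 0) * C1"
    by (intro tendsto_lowerbound) auto
  then show False
    using truncated_power_mass_pos[of \<beta> k, where 'a='a] by (simp add: C0_def)
qed

theorem theorem1p13:
  fixes \<gamma> \<alpha> s :: real and q :: ennreal
  assumes "1 \<le> q"
    and "\<alpha> > max 1 (fujita_exponent CARD('d::finite) \<gamma>)"
    and "s > critical_weight CARD('d) \<gamma> \<alpha> q"
  shows "\<exists>u0 :: real^'d \<Rightarrow> real. u0 \<in> weighted_Lq q s \<and> (\<forall>x. 0 \<le> u0 x) \<and>
           \<not> (\<exists>T>0. \<exists>u. positive_weak_solution \<gamma> \<alpha> T u0 u)"
proof -
  have "(2 + \<gamma>) / real CARD('d) < \<alpha> - 1" and \<alpha>: "1 < \<alpha>"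
    using assms(2) by (simp_all add: fujita_exponent_def)
  then have "2 + \<gamma> < real CARD('d) * (\<alpha> - 1)"
    by (simp add: pos_divide_less_eq mult.commute)
  then have \<gamma>: "\<gamma> < real DIM(real^'d) * (\<alpha> - 1)" by simp
  have "(2 + \<gamma>) / (\<alpha> - 1) < s + enn2real (of_nat DIM(real^'d) / q)"
    using assms(3) by (simp add: critical_weight_def)
  then obtain \<beta> where \<beta>: "(2 + \<gamma>) / (\<alpha> - 1) < \<beta>" "\<beta> < s + enn2real (of_nat DIM(real^'d) / q)"
    using dense by blast
  show ?thesis
    using truncated_power_in_weighted_Lq[OF assms(1) \<beta>(2)] truncated_power_nonneg
      no_positive_weak_solution_truncated_power[OF \<alpha> \<gamma> \<beta>(1)]
    by (intro exI[of _ "truncated_power \<beta>"]) auto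
qed

end
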